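(* Let $\mathcal A$ be an algebra with unit $e$ over the field $\mathbb K=\mathbb R$ or $\mathbb C$ with $\dim\mathcal A\ge2$, satisfying: (i) $\mathcal A$ is provided with a Hilbert inner product $(\cdot\mid\cdot)$ normalized at the unit, $\|e\|^2=(e\mid e)=1$; (ii) there exists at least one element $f\in\mathcal A$, $f\ne0$, such that each two of the elements $e$, $f$ and $f^2=f\circ f$ are orthogonal. Then, if $c<\sqrt{4/3}$, the norm estimate $\|F\circ G\|\le c\,\|F\|\,\|G\|$ is not valid for some $F,G\in\mathcal A$.
   Context: $\circ$ denotes the product of $\mathcal A$ and $\|F\|=\sqrt{(F\mid F)}$. "Hilbert inner product" means a positive definite inner product. *)

theory Defs
  imports Complex_Main
begin

text \<open>
  As usual for a linear space, the dimension condition allows infinite bases; the library's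
  \<open>dim\<close> is \<open>0\<close> on infinite-dimensional spaces and so cannot express it.
\<close>

context vector_space
begin

definition dim_at_least :: "nat \<Rightarrow> bool" where
  "dim_at_least n \<longleftrightarrow>
     (\<exists>B. independent B \<and> span B = UNIV \<and> (infinite B \<or> n \<le> card B))"

end

text \<open>Associativity and commutativity of the product are not part of the notion of algebra here.\<close>

locale unital_algebra = vector_space scale
  for scale :: "'k::field \<Rightarrow> 'a::ab_group_add \<Rightarrow> 'a" +
  fixes mult :: "'a \<Rightarrow> 'a \<Rightarrow> 'a" and unit :: 'a
  assumes linear_mult_left: "Vector_Spaces.linear scale scale (\<lambda>x. mult x y)"
    and linear_mult_right: "Vector_Spaces.linear scale scale (\<lambda>y. mult x y)"
    and unit_left: "mult unit x = x"
    and unit_right: "mult x unit = x"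

text \<open>
  The scalar field enters through its conjugation \<open>conjg\<close> and real part \<open>re\<close>: these are
  the identity maps for \<open>\<real>\<close>, and \<^const>\<open>cnj\<close> and \<^const>\<open>Re\<close> for the complex numbers.
  Hermitian symmetry makes \<open>ip x x\<close> real, so \<open>re (ip x x)\<close> is \<open>ip x x\<close> itself, read as a
  real number. Completeness is not required.
\<close>

locale hilbert_inner_product = vector_space scale
  for scale :: "'k::field \<Rightarrow> 'a::ab_group_add \<Rightarrow> 'a" +
  fixes conjg :: "'k \<Rightarrow> 'k" and re :: "'k \<Rightarrow> real" and ip :: "'a \<Rightarrow> 'a \<Rightarrow> 'k"
  assumes linear_ip_left: "Vector_Spaces.linear scale (*) (\<lambda>x. ip x y)"
    and hermitian: "ip y x = conjg (ip x y)"
    and positive_definite: "x \<noteq> 0 \<Longrightarrow> 0 < re (ip x x)"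

definition ip_norm :: "('k \<Rightarrow> real) \<Rightarrow> ('a \<Rightarrow> 'a \<Rightarrow> 'k) \<Rightarrow> 'a \<Rightarrow> real" where
  "ip_norm re ip x = sqrt (re (ip x x))"

locale hilbert_unital_algebra =
  unital_algebra scale mult unit + hilbert_inner_product scale conjg re ip
  for scale :: "'k::field \<Rightarrow> 'a::ab_group_add \<Rightarrow> 'a"
    and mult :: "'a \<Rightarrow> 'a \<Rightarrow> 'a" and unit :: 'a
    and conjg :: "'k \<Rightarrow> 'k" and re :: "'k \<Rightarrow> real" and ip :: "'a \<Rightarrow> 'a \<Rightarrow> 'k" +
  assumes dim_ge_2: "dim_at_least 2"
    and ip_unit: "ip unit unit = 1"

abbreviation real_hilbert_unital_algebra ::
    "(real \<Rightarrow> 'a::ab_group_add \<Rightarrow> 'a) \<Rightarrow> ('a \<Rightarrow> 'a \<Rightarrow> 'a) \<Rightarrow> 'a \<Rightarrow> ('a \<Rightarrow> 'a \<Rightarrow> real) \<Rightarrow> bool" where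
  "real_hilbert_unital_algebra scale mult unit ip \<equiv>
     hilbert_unital_algebra scale mult unit (\<lambda>a. a) (\<lambda>a. a) ip"

abbreviation complex_hilbert_unital_algebra ::
    "(complex \<Rightarrow> 'a::ab_group_add \<Rightarrow> 'a) \<Rightarrow> ('a \<Rightarrow> 'a \<Rightarrow> 'a) \<Rightarrow> 'a \<Rightarrow> ('a \<Rightarrow> 'a \<Rightarrow> complex) \<Rightarrow> bool" where
  "complex_hilbert_unital_algebra scale mult unit ip \<equiv>
     hilbert_unital_algebra scale mult unit cnj Re ip"

abbreviation real_ip_norm :: "('a \<Rightarrow> 'a \<Rightarrow> real) \<Rightarrow> 'a \<Rightarrow> real" where
  "real_ip_norm \<equiv> ip_norm (\<lambda>a. a)"

abbreviation complex_ip_norm :: "('a \<Rightarrow> 'a \<Rightarrow> complex) \<Rightarrow> 'a \<Rightarrow> real" where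
  "complex_ip_norm \<equiv> ip_norm Re"

definition has_orthogonal_square ::
    "('a::zero \<Rightarrow> 'a \<Rightarrow> 'a) \<Rightarrow> 'a \<Rightarrow> ('a \<Rightarrow> 'a \<Rightarrow> 'k::zero) \<Rightarrow> bool" where
  "has_orthogonal_square mult unit ip \<longleftrightarrow>
     (\<exists>f. f \<noteq> 0 \<and> ip unit f = 0 \<and> ip unit (mult f f) = 0 \<and> ip f (mult f f) = 0)"

end

theory Submission
  imports Defs
begin

text \<open>
  Scale \<open>f\<close> to \<open>g\<close> with \<open>\<parallel>g\<parallel>\<^sup>2 = 1/2\<close>. For \<open>F = e + g\<close> orthogonality gives
  \<open>\<parallel>F\<parallel>\<^sup>2 = 3/2\<close> and \<open>\<parallel>F \<circ> F\<parallel>\<^sup>2 = \<parallel>e + 2 g + g \<circ> g\<parallel>\<^sup>2 = 1 + 2 + \<parallel>g \<circ> g\<parallel>\<^sup>2 \<ge> 3\<close>,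
  while \<open>c \<parallel>F\<parallel>\<^sup>2 < sqrt (4/3) * (3/2) = sqrt 3\<close>. The value \<open>1/2\<close> maximizes
  \<open>(1 + 4 u) / (1 + u)\<^sup>2\<close> over \<open>u = \<parallel>g\<parallel>\<^sup>2\<close>.
\<close>

text \<open>The real and the complex case are treated at once: identity, \<open>cnj\<close> and
  \<open>Re\<close> are all linear over the reals, and the argument uses nothing else about
  \<open>conjg\<close> and \<open>re\<close> until \<open>re_1\<close> fixes the
  normalization.\<close>

locale real_linear_hilbert_inner_product = hilbert_inner_product scale conjg re ip
  for scale :: "'k::real_field \<Rightarrow> 'a::ab_group_add \<Rightarrow> 'a"
    and conjg :: "'k \<Rightarrow> 'k" and re :: "'k \<Rightarrow> real" and ip :: "'a \<Rightarrow> 'a \<Rightarrow> 'k" +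
  assumes linear_conjg: "linear conjg"
    and linear_re: "linear re"
begin

lemma ip_add_left: "ip (x + y) z = ip x z + ip y z"
  using linear_ip_left[of z] by (simp add: Vector_Spaces.linear_iff)

lemma ip_scale_left: "ip (scale a x) z = a * ip x z"
  using linear_ip_left[of z] by (simp add: Vector_Spaces.linear_iff)

lemma ip_add_right: "ip z (x + y) = ip z x + ip z y"
  by (metis hermitian ip_add_left linear_conjg linear_add)

text \<open>Only real scalars, because they pass through \<open>conjg\<close> unchanged; a general
  scalar would come out conjugated.\<close>

lemma ip_scale_right: "ip z (scale (of_real r) x) = of_real r * ip z x"
  by (metis hermitian ip_scale_left linear_conjg linear_cmul scaleR_conv_of_real)

lemma ip_orthogonal_sym: "ip x y = 0 \<Longrightarrow> ip y x = 0"
  using linear_0[OF linear_conjg] hermitian[of y x] by simp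

lemma re_ip_scale: "re (ip (scale (of_real r) x) (scale (of_real r) x)) = r\<^sup>2 * re (ip x x)"
proof -
  have "re (of_real r * a) = r * re a" for a
    using linear_cmul[OF linear_re, of r a] by (simp add: scaleR_conv_of_real)
  then show ?thesis
    by (simp add: ip_scale_left ip_scale_right power2_eq_square mult.assoc)
qed

lemma re_ip_nonneg: "0 \<le> re (ip x x)"
proof (cases "x = 0")
  case True
  have "ip 0 0 = 0"
    using ip_scale_left[of 0 0 0] by simp
  then show ?thesis
    using True linear_0[OF linear_re] by simp
next
  case False
  then show ?thesis
    using positive_definite[of x] by simp
qed

lemma pythagoras:
  assumes "ip x y = 0"
  shows "re (ip (x + y) (x + y)) = re (ip x x) + re (ip y y)"
  using assms ip_orthogonal_sym[OF assms]
  by (simp add: ip_add_left ip_add_right linear_add[OF linear_re])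

lemma re_ip_normalize:
  assumes "x \<noteq> 0" "0 \<le> s"
  obtains r where "re (ip (scale (of_real r) x) (scale (of_real r) x)) = s"
proof
  show "re (ip (scale (of_real (sqrt (s / re (ip x x)))) x)
      (scale (of_real (sqrt (s / re (ip x x)))) x)) = s"
    using positive_definite[OF assms(1)] assms(2) by (simp add: re_ip_scale)
qed

end

text \<open>Real linearity leaves \<open>re\<close> free up to a positive factor. With
  \<open>re_1\<close>, the scalar equation \<open>ip_unit\<close> gives the unit squared norm
  1.\<close>

locale real_linear_hilbert_unital_algebra =
  hilbert_unital_algebra scale mult unit conjg re ip +
  real_linear_hilbert_inner_product scale conjg re ip
  for scale :: "'k::real_field \<Rightarrow> 'a::ab_group_add \<Rightarrow> 'a"
    and mult :: "'a \<Rightarrow> 'a \<Rightarrow> 'a" and unit :: 'a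
    and conjg :: "'k \<Rightarrow> 'k" and re :: "'k \<Rightarrow> real" and ip :: "'a \<Rightarrow> 'a \<Rightarrow> 'k" +
  assumes re_1: "re 1 = 1"
begin

lemma mult_add_left: "mult (x + y) z = mult x z + mult y z"
  using linear_mult_left[of z] by (simp add: Vector_Spaces.linear_iff)

lemma mult_add_right: "mult z (x + y) = mult z x + mult z y"
  using linear_mult_right[of z] by (simp add: Vector_Spaces.linear_iff)

lemma mult_scale_scale: "mult (scale a x) (scale b y) = scale (a * b) (mult x y)"
  using linear_mult_left[of "scale b y"] linear_mult_right[of x] by (simp add: Vector_Spaces.linear_iff)

lemma not_norm_mult_le:
  assumes c: "c < sqrt (4 / 3)" and "has_orthogonal_square mult unit ip"
  shows "\<exists>F G. \<not> ip_norm re ip (mult F G) \<le> c * ip_norm re ip F * ip_norm re ip G"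
proof -
  obtain f where f: "f \<noteq> 0" "ip unit f = 0" "ip unit (mult f f) = 0" "ip f (mult f f) = 0"
    using assms(2) by (auto simp: has_orthogonal_square_def)
  obtain r where r: "re (ip (scale (of_real r) f) (scale (of_real r) f)) = 1 / 2"
    using re_ip_normalize[OF f(1), of "1 / 2"] by auto
  define g where "g = scale (of_real r) f"
  have gg: "mult g g = scale (of_real (r * r)) (mult f f)"
    by (simp add: g_def mult_scale_scale)
  \<comment> \<open>Orthogonality survives scaling. Keeping \<open>of_real (r * r)\<close> in one
    piece lets \<open>ip_scale_right\<close> match.\<close>
  have orth: "ip unit g = 0" "ip unit (mult g g) = 0" "ip g (mult g g) = 0"
    unfolding gg using f by (simp_all add: g_def ip_scale_left ip_scale_right del: of_real_mult)
  have g: "re (ip g g) = 1 / 2"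
    using r by (simp add: g_def)
  define F where "F = unit + g"
  have F: "re (ip F F) = 3 / 2"
    by (simp add: F_def pythagoras orth g ip_unit re_1)
  \<comment> \<open>Additivity gives four copies of \<open>ip g g\<close>, each with real part
    1/2.\<close>
  have "re (ip (g + g) (g + g)) = 2"
    using g linear_cmul[OF linear_re, of 4 "ip g g"]
    by (simp add: ip_add_left ip_add_right scaleR_conv_of_real)
  moreover have "ip (g + g) (mult g g) = 0" "ip unit ((g + g) + mult g g) = 0"
    by (simp_all add: ip_add_left[of g g] ip_add_right[of unit] orth)
  \<comment> \<open>The bracketing allows two uses of \<open>pythagoras\<close>: first split off
    \<open>unit\<close>, then separate \<open>g + g\<close> from \<open>mult g g\<close>.\<close>
  ultimately have "re (ip (unit + ((g + g) + mult g g)) (unit + ((g + g) + mult g g)))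
      = 3 + re (ip (mult g g) (mult g g))"
    by (simp add: pythagoras ip_unit re_1)
  \<comment> \<open>Both cross terms are products with \<open>unit\<close>, so commutativity is not
    involved.\<close>
  moreover have "mult F F = unit + ((g + g) + mult g g)"
    by (simp add: F_def mult_add_left mult_add_right unit_left unit_right add.assoc)
  ultimately have "3 \<le> re (ip (mult F F) (mult F F))"
    using re_ip_nonneg[of "mult g g"] by simp
  then have "sqrt 3 \<le> ip_norm re ip (mult F F)"
    by (simp add: ip_norm_def)
  moreover have "c * ip_norm re ip F * ip_norm re ip F = c * (3 / 2)"
    by (simp add: ip_norm_def F mult.assoc)
  \<comment> \<open>The bound on \<open>c\<close> times the squared norm of \<open>F\<close> is
    exactly the lower bound for the norm of its square. The factor 3/2 is positive, so the sign of
    \<open>c\<close> does not matter, and \<open>F\<close> serves as both witnesses.\<close>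
  moreover have "sqrt (4 / 3) * (3 / 2) = sqrt 3"
    by (rule real_sqrt_unique[symmetric]) (simp_all add: power_mult_distrib power_divide)
  ultimately show ?thesis
    using c by (intro exI[of _ F]) linarith
qed

end

theorem lemma12:
  fixes c :: real
    and scaleR :: "real \<Rightarrow> 'a::ab_group_add \<Rightarrow> 'a" and multR :: "'a \<Rightarrow> 'a \<Rightarrow> 'a"
    and eR :: 'a and ipR :: "'a \<Rightarrow> 'a \<Rightarrow> real"
    and scaleC :: "complex \<Rightarrow> 'b::ab_group_add \<Rightarrow> 'b" and multC :: "'b \<Rightarrow> 'b \<Rightarrow> 'b"
    and eC :: 'b and ipC :: "'b \<Rightarrow> 'b \<Rightarrow> complex"
  assumes "c < sqrt (4 / 3)"
  shows "(real_hilbert_unital_algebra scaleR multR eR ipR \<and> has_orthogonal_square multR eR ipR \<longrightarrow>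
      (\<exists>F G. \<not> real_ip_norm ipR (multR F G) \<le> c * real_ip_norm ipR F * real_ip_norm ipR G))
    \<and> (complex_hilbert_unital_algebra scaleC multC eC ipC \<and> has_orthogonal_square multC eC ipC \<longrightarrow>
      (\<exists>F G. \<not> complex_ip_norm ipC (multC F G) \<le> c * complex_ip_norm ipC F * complex_ip_norm ipC G))"
proof (intro conjI impI; elim conjE)
  assume "real_hilbert_unital_algebra scaleR multR eR ipR" and sq: "has_orthogonal_square multR eR ipR"
  then interpret hilbert_unital_algebra scaleR multR eR "\<lambda>a. a" "\<lambda>a. a" ipR
    by simp
  interpret real_linear_hilbert_unital_algebra scaleR multR eR "\<lambda>a. a" "\<lambda>a. a" ipR
    by unfold_locales (auto intro: linearI)
  show "\<exists>F G. \<not> real_ip_norm ipR (multR F G) \<le> c * real_ip_norm ipR F * real_ip_norm ipR G"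
    using assms sq by (rule not_norm_mult_le)
next
  assume "complex_hilbert_unital_algebra scaleC multC eC ipC" and sq: "has_orthogonal_square multC eC ipC"
  then interpret hilbert_unital_algebra scaleC multC eC cnj Re ipC
    by simp
  \<comment> \<open>\<open>cnj\<close> is not complex linear, but real linearity is all that is
    required.\<close>
  interpret real_linear_hilbert_unital_algebra scaleC multC eC cnj Re ipC
    by unfold_locales (auto intro: linearI)
  show "\<exists>F G. \<not> complex_ip_norm ipC (multC F G) \<le> c * complex_ip_norm ipC F * complex_ip_norm ipC G"
    using assms sq by (rule not_norm_mult_le)
qed

end
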